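(* Suppose that $F$ is an $r$-graph on $m$ vertices and $P$ is a minimal pattern such that $(F,P)$ is a Turán pair and $F$ is edge-stable with respect to $P$ and weakly vertex-extendable (or vertex-extendable) with respect to $P$. Then there exists a constant $c>0$ such that for all sufficiently large $n$, $F$ is $\left(c\binom{n-1}{r-1}, \frac{1-\pi(F)}{8m}\binom{n-1}{r-1}\right)$-bounded; that is, every $F$-free $r$-graph $\mathcal{H}$ on $n$ vertices with $d(\mathcal{H}) \ge d(n,F) - c\binom{n-1}{r-1}$ satisfies $\Delta(\mathcal{H}) \le d(n,F) + \frac{1-\pi(F)}{8m}\binom{n-1}{r-1}$.
   Context: An $r$-graph is a collection of $r$-subsets of a finite vertex set. $\mathrm{ex}(n,F)$ is the Turán number, $\pi(F)=\lim\mathrm{ex}(n,F)/\binom{n}{r}$, $d(n,F):=r\cdot\mathrm{ex}(n,F)/n$; $d(\mathcal{H}),\Delta(\mathcal{H}),\delta(\mathcal{H})$ are average, maximum and minimum degree. An $r$-multiset is an unordered collection of $r$ elements with repetition. A pattern $P=(k,E)$ is a positive integer $k$ with a collection $E$ of $r$-multisets on $[k]$. For a partition $V=V_1\cup\dots\cup V_k$, the profile of an $r$-set $X\subseteq V$ is the multiset containing $i$ with multiplicity $|X\cap V_i|$; a $P$-construction on $V$ is the $r$-graph of all $r$-subsets of $V$ whose profile lies in $E$, for some partition; a $P$-subconstruction is a subgraph of a $P$-construction. $\lambda(P)=\lim_n \Lambda(P,n)/\binom{n}{r}$ where $\Lambda(P,n)$ is the maximum number of edges of an $n$-vertex $P$-construction;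 $P-i$ removes $i$ and all multisets containing $i$; $P$ is minimal if $\lambda(P-i)<\lambda(P)$ for all $i\in[k]$. $(F,P)$ is a Turán pair if every $P$-construction is $F$-free and every $n$-vertex $F$-free $r$-graph with $\mathrm{ex}(n,F)$ edges is a $P$-construction. For a Turán pair: $F$ is edge-stable w.r.t. $P$ if for every $\delta>0$ there are $N_0,\zeta>0$ such that every $F$-free $r$-graph $\mathcal{H}$ on $n\ge N_0$ vertices with at least $(\pi(F)-\zeta)\binom{n}{r}$ edges has a subgraph with at least $(\pi(F)-\delta)\binom{n}{r}$ edges that is a $P$-subconstruction. $F$ is vertex-extendable w.r.t. $P$ if there are $N_0,\zeta>0$ such that for every $F$-free $\mathcal{H}$ on $n\ge N_0$ vertices with $\delta(\mathcal{H})\ge(\pi(F)-\zeta)\binom{n-1}{r-1}$: if $\mathcal{H}-v$ is a $P$-subconstruction for some vertex $v$, then $\mathcal{H}$ is a $P$-subconstruction. $F$ is weakly vertex-extendable w.r.t. $P$ if for every $\delta>0$ there are $N_0,\zeta>0$ such that for every $F$-free $\mathcal{H}$ on $n\ge N_0$ vertices with $\delta(\mathcal{H})\ge(\pi(F)-\zeta)\binom{n-1}{r-1}$: if $\mathcal{H}-v$ is a $P$-subconstruction for some vertex $v$, then $d_{\mathcal{H}}(v)\le(\pi(F)+\delta)\binom{n-1}{r-1}$. *)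

theory Defs
  imports Complex_Main "HOL-Library.Multiset" "HOL-Library.Disjoint_Sets"
begin

section \<open>Hypergraphs\<close>

text \<open>A hypergraph is a pair of a vertex set and an edge set. Vertices are natural numbers,
  which loses nothing up to isomorphism; the vertex set may be any finite set of naturals.\<close>

type_synonym hgraph = "nat set \<times> nat set set"

abbreviation verts :: "hgraph \<Rightarrow> nat set" where "verts H \<equiv> fst H"

abbreviation edges :: "hgraph \<Rightarrow> nat set set" where "edges H \<equiv> snd H"

definition r_graph :: "nat \<Rightarrow> hgraph \<Rightarrow> bool" where
  "r_graph r H \<longleftrightarrow> finite (verts H) \<and> (\<forall>e\<in>edges H. e \<subseteq> verts H \<and> card e = r)"

definition subgraph :: "hgraph \<Rightarrow> hgraph \<Rightarrow> bool" where
  "subgraph G H \<longleftrightarrow> verts G \<subseteq> verts H \<and> edges G \<subseteq> edges H"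

text \<open>Copies of \<open>F\<close> are not required to be induced.\<close>

definition free :: "hgraph \<Rightarrow> hgraph \<Rightarrow> bool" where
  "free F H \<longleftrightarrow> \<not> (\<exists>f. inj_on f (verts F) \<and> f ` verts F \<subseteq> verts H \<and> (\<forall>e\<in>edges F. f ` e \<in> edges H))"

definition remove_vertex :: "hgraph \<Rightarrow> nat \<Rightarrow> hgraph" where
  "remove_vertex H v = (verts H - {v}, {e \<in> edges H. v \<notin> e})"

definition degree :: "hgraph \<Rightarrow> nat \<Rightarrow> nat" where
  "degree H v = card {e \<in> edges H. v \<in> e}"

definition avg_degree :: "hgraph \<Rightarrow> real" where
  "avg_degree H = (\<Sum>v\<in>verts H. real (degree H v)) / real (card (verts H))"

definition max_degree :: "hgraph \<Rightarrow> nat" where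
  "max_degree H = Max (degree H ` verts H)"

definition min_degree :: "hgraph \<Rightarrow> nat" where
  "min_degree H = Min (degree H ` verts H)"

section \<open>Turan numbers\<close>

text \<open>The uniformity \<open>r\<close> is an explicit argument. The suprema below are over bounded sets of
  naturals, hence maxima; the library convention is \<open>Sup {} = 0\<close>.\<close>

definition turan_ex :: "nat \<Rightarrow> nat \<Rightarrow> hgraph \<Rightarrow> nat" where
  "turan_ex r n F = Sup {card (edges H) | H. r_graph r H \<and> card (verts H) = n \<and> free F H}"

definition turan_density :: "nat \<Rightarrow> hgraph \<Rightarrow> real" where
  "turan_density r F = lim (\<lambda>n. real (turan_ex r n F) / real (n choose r))"

definition turan_degree :: "nat \<Rightarrow> nat \<Rightarrow> hgraph \<Rightarrow> real" where
  "turan_degree r n F = real r * real (turan_ex r n F) / real n"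

section \<open>Patterns\<close>

text \<open>A pattern is stored as its index set together with its collection of multisets, so that
  deleting an index needs no relabelling; \<open>(k, E)\<close> is represented by \<open>({1..k}, E)\<close>.\<close>

type_synonym pattern = "nat set \<times> nat multiset set"

definition is_pattern :: "nat \<Rightarrow> pattern \<Rightarrow> bool" where
  "is_pattern r P \<longleftrightarrow> (\<exists>k\<ge>1. fst P = {1..k}) \<and> (\<forall>A\<in>snd P. size A = r \<and> set_mset A \<subseteq> fst P)"

definition pattern_remove :: "pattern \<Rightarrow> nat \<Rightarrow> pattern" where
  "pattern_remove P i = (fst P - {i}, {A \<in> snd P. i \<notin># A})"

text \<open>Parts \<open>W i\<close> of a partition are allowed to be empty.\<close>

definition is_partition :: "nat set \<Rightarrow> (nat \<Rightarrow> nat set) \<Rightarrow> nat set \<Rightarrow> bool" where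
  "is_partition I W V \<longleftrightarrow> disjoint_family_on W I \<and> (\<Union>i\<in>I. W i) = V"

definition profile :: "nat set \<Rightarrow> (nat \<Rightarrow> nat set) \<Rightarrow> nat set \<Rightarrow> nat multiset" where
  "profile I W X = (\<Sum>i\<in>I. replicate_mset (card (X \<inter> W i)) i)"

definition construction :: "nat \<Rightarrow> pattern \<Rightarrow> hgraph \<Rightarrow> bool" where
  "construction r P H \<longleftrightarrow> finite (verts H) \<and>
     (\<exists>W. is_partition (fst P) W (verts H) \<and>
          edges H = {X. X \<subseteq> verts H \<and> card X = r \<and> profile (fst P) W X \<in> snd P})"

definition subconstruction :: "nat \<Rightarrow> pattern \<Rightarrow> hgraph \<Rightarrow> bool" where
  "subconstruction r P H \<longleftrightarrow> (\<exists>G. construction r P G \<and> subgraph H G)"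

definition pattern_max :: "nat \<Rightarrow> pattern \<Rightarrow> nat \<Rightarrow> nat" where
  "pattern_max r P n = Sup {card (edges H) | H. construction r P H \<and> card (verts H) = n}"

text \<open>If the only index of a one-index pattern is removed, no constructions on nonempty vertex
  sets remain, and the density below is \<open>0\<close> because \<open>Sup {} = 0\<close>.\<close>

definition pattern_density :: "nat \<Rightarrow> pattern \<Rightarrow> real" where
  "pattern_density r P = lim (\<lambda>n. real (pattern_max r P n) / real (n choose r))"

definition minimal_pattern :: "nat \<Rightarrow> pattern \<Rightarrow> bool" where
  "minimal_pattern r P \<longleftrightarrow>
     (\<forall>i\<in>fst P. pattern_density r (pattern_remove P i) < pattern_density r P)"

section \<open>Turan pairs, stability and extendability\<close>

definition turan_pair :: "nat \<Rightarrow> hgraph \<Rightarrow> pattern \<Rightarrow> bool" where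
  "turan_pair r F P \<longleftrightarrow>
     (\<forall>H. construction r P H \<longrightarrow> free F H) \<and>
     (\<forall>H. r_graph r H \<and> free F H \<and> card (edges H) = turan_ex r (card (verts H)) F
        \<longrightarrow> construction r P H)"

definition edge_stable :: "nat \<Rightarrow> hgraph \<Rightarrow> pattern \<Rightarrow> bool" where
  "edge_stable r F P \<longleftrightarrow>
     (\<forall>\<delta>::real. \<delta> > 0 \<longrightarrow> (\<exists>N\<^sub>0::nat. \<exists>\<zeta>::real. \<zeta> > 0 \<and>
        (\<forall>H n. r_graph r H \<and> free F H \<and> card (verts H) = n \<and> n \<ge> N\<^sub>0 \<and>
             real (card (edges H)) \<ge> (turan_density r F - \<zeta>) * real (n choose r)
           \<longrightarrow> (\<exists>G. r_graph r G \<and> subgraph G H \<and> subconstruction r P G \<and>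
                  real (card (edges G)) \<ge> (turan_density r F - \<delta>) * real (n choose r)))))"

definition vertex_extendable :: "nat \<Rightarrow> hgraph \<Rightarrow> pattern \<Rightarrow> bool" where
  "vertex_extendable r F P \<longleftrightarrow>
     (\<exists>N\<^sub>0::nat. \<exists>\<zeta>::real. \<zeta> > 0 \<and>
        (\<forall>H n. r_graph r H \<and> free F H \<and> card (verts H) = n \<and> n \<ge> N\<^sub>0 \<and>
             real (min_degree H) \<ge> (turan_density r F - \<zeta>) * real ((n - 1) choose (r - 1))
           \<longrightarrow> (\<exists>v\<in>verts H. subconstruction r P (remove_vertex H v))
           \<longrightarrow> subconstruction r P H))"

definition weakly_vertex_extendable :: "nat \<Rightarrow> hgraph \<Rightarrow> pattern \<Rightarrow> bool" where
  "weakly_vertex_extendable r F P \<longleftrightarrow>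
     (\<forall>\<delta>::real. \<delta> > 0 \<longrightarrow> (\<exists>N\<^sub>0::nat. \<exists>\<zeta>::real. \<zeta> > 0 \<and>
        (\<forall>H n. r_graph r H \<and> free F H \<and> card (verts H) = n \<and> n \<ge> N\<^sub>0 \<and>
             real (min_degree H) \<ge> (turan_density r F - \<zeta>) * real ((n - 1) choose (r - 1))
           \<longrightarrow> (\<forall>v\<in>verts H. subconstruction r P (remove_vertex H v) \<longrightarrow>
                  real (degree H v) \<le> (turan_density r F + \<delta>) * real ((n - 1) choose (r - 1))))))"

text \<open>\<open>(a, b)\<close>-boundedness of \<open>F\<close> at a fixed number \<open>n\<close> of vertices.\<close>

definition degree_bounded :: "nat \<Rightarrow> hgraph \<Rightarrow> nat \<Rightarrow> real \<Rightarrow> real \<Rightarrow> bool" where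
  "degree_bounded r F n a b \<longleftrightarrow>
     (\<forall>H. r_graph r H \<and> free F H \<and> card (verts H) = n \<and> avg_degree H \<ge> turan_degree r n F - a
        \<longrightarrow> real (max_degree H) \<le> turan_degree r n F + b)"

end

(* Cloning a vertex u of a P-subconstruction G keeps it a P-subconstruction, so
   |G| + t * deg u <= ex(n + t). Since ex(n + t) <= (pi + o(1)) * binom(n + t, r), taking t to be a
   small multiple of n shows that a near-extremal P-subconstruction has no vertex of degree above
   (pi + eta) * binom(n - 1, r - 1). In particular vertex-extendability implies its weak form.

   Let H be F-free with nearly extremal average degree. Edge-stability gives a near-extremal
   P-subconstruction G in H. As no degree of G exceeds the average by much, only few vertices have
   low degree in G. Delete them, and restore at a vertex v of maximum degree all edges of H
   that avoid them: the result has large minimum degree and becomes a P-subconstruction without v,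
   so weak vertex-extendability bounds the degree of v. *)
theory Submission imports Defs begin

section \<open>Subconstructions as vertex colourings\<close>

text \<open>Both multisets count, for each index, the vertices of \<open>X\<close> with that colour.
  Image multisets are easier to follow than profiles when an edge is altered.\<close>

lemma profile_eq_image_mset:
  assumes "finite I" "finite X"
    and "\<And>x. x \<in> X \<Longrightarrow> f x \<in> I" and "\<And>x i. x \<in> X \<Longrightarrow> i \<in> I \<Longrightarrow> x \<in> W i \<longleftrightarrow> f x = i"
  shows "profile I W X = image_mset f (mset_set X)"
proof (rule multiset_eqI)
  fix j
  have "count (profile I W X) j = (\<Sum>i\<in>I. if j = i then card (X \<inter> W i) else 0)"
    unfolding profile_def count_sum by (intro sum.cong) auto
  also have "\<dots> = (if j \<in> I then card (X \<inter> W j) else 0)"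
    using assms(1) by (simp add: sum.delta)
  also have "\<dots> = card {x \<in> X. f x = j}"
  proof (cases "j \<in> I")
    case True
    have "X \<inter> W j = {x \<in> X. f x = j}" using assms(4) True by auto
    then show ?thesis using True by simp
  next
    case False
    have *: "{x \<in> X. f x = j} = {}" using assms(3) False by auto
    show ?thesis unfolding * using False by simp
  qed
  also have "\<dots> = count (image_mset f (mset_set X)) j"
    using assms(2) by (simp add: count_image_mset' eq_commute)
  finally show "count (profile I W X) j = count (image_mset f (mset_set X)) j" .
qed

text \<open>Encodes a subconstruction by one colour map instead of a partition. The map is total and
  the vertex set of \<open>H\<close> does not occur, so the same map serves every hypergraph whose
  edges are among those of \<open>H\<close>.\<close>

definition pattern_colouring :: "pattern \<Rightarrow> (nat \<Rightarrow> nat) \<Rightarrow> hgraph \<Rightarrow> bool" where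
  "pattern_colouring P f H \<longleftrightarrow>
     (\<forall>v. f v \<in> fst P) \<and> (\<forall>e\<in>edges H. image_mset f (mset_set e) \<in> snd P)"

lemma r_graph_edgeD:
  assumes "r_graph r H" "e \<in> edges H"
  shows "e \<subseteq> verts H" "card e = r" "finite e"
  using assms finite_subset by (auto simp: r_graph_def)

lemma r_graph_finite_edges: "r_graph r H \<Longrightarrow> finite (edges H)"
  by (rule finite_subset[of _ "Pow (verts H)"]) (auto simp: r_graph_def)

lemma is_pattern_finite: "is_pattern r P \<Longrightarrow> finite (fst P)"
  by (auto simp: is_pattern_def)

lemma subconstruction_imp_colouring:
  assumes "is_pattern r P" "r_graph r H" "subconstruction r P H"
  shows "\<exists>f. pattern_colouring P f H"
proof -
  from assms(3) obtain G W where G: "finite (verts G)" "is_partition (fst P) W (verts G)"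
    "edges G = {X. X \<subseteq> verts G \<and> card X = r \<and> profile (fst P) W X \<in> snd P}" "subgraph H G"
    by (auto simp: subconstruction_def construction_def)
  have i0: "1 \<in> fst P" using assms(1) by (auto simp: is_pattern_def)
  \<comment> \<open>The default colour 1 outside \<open>G\<close> is available because a pattern has
    at least one index; it only makes \<open>f\<close> total.\<close>
  define f where "f = (\<lambda>v. if v \<in> verts G then SOME i. i \<in> fst P \<and> v \<in> W i else 1)"
  have f: "f v \<in> fst P \<and> v \<in> W (f v)" if "v \<in> verts G" for v
  proof -
    have "\<exists>i. i \<in> fst P \<and> v \<in> W i" using G(2) that by (auto simp: is_partition_def)
    from someI_ex[OF this] show ?thesis using that by (simp add: f_def)
  qed
  have uniq: "v \<in> W i \<longleftrightarrow> f v = i" if "v \<in> verts G" "i \<in> fst P" for v i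
    using G(2) f[OF that(1)] that by (auto simp: is_partition_def disjoint_family_on_def)
  have "image_mset f (mset_set e) \<in> snd P" if e: "e \<in> edges H" for e
  proof -
    have eG: "e \<in> edges G" using e G(4) by (auto simp: subgraph_def)
    then have "e \<subseteq> verts G" using G(3) by auto
    then have "profile (fst P) W e = image_mset f (mset_set e)"
      using f uniq finite_subset[OF _ G(1)] is_pattern_finite[OF assms(1)]
      by (intro profile_eq_image_mset) auto
    then show ?thesis using eG G(3) by auto
  qed
  moreover have "f v \<in> fst P" for v using f i0 by (cases "v \<in> verts G") (auto simp: f_def)
  ultimately show ?thesis by (auto simp: pattern_colouring_def)
qed

lemma colouring_imp_subconstruction:
  assumes "is_pattern r P" "r_graph r H" "pattern_colouring P f H"
  shows "subconstruction r P H"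
proof -
  define W where "W = (\<lambda>i. {v \<in> verts H. f v = i})"
  define G where "G = (verts H, {X. X \<subseteq> verts H \<and> card X = r \<and> profile (fst P) W X \<in> snd P})"
  have "is_partition (fst P) W (verts H)"
    using assms(3) by (auto simp: is_partition_def disjoint_family_on_def W_def pattern_colouring_def)
  then have "construction r P G"
    using assms(2) by (auto simp: construction_def G_def r_graph_def)
  moreover have "profile (fst P) W e = image_mset f (mset_set e)" if "e \<in> edges H" for e
    using r_graph_edgeD[OF assms(2) that] is_pattern_finite[OF assms(1)] assms(3)
    by (intro profile_eq_image_mset) (auto simp: W_def pattern_colouring_def)
  then have "subgraph H G"
    using assms(2,3) by (auto simp: subgraph_def G_def pattern_colouring_def r_graph_def)
  ultimately show ?thesis unfolding subconstruction_def by blast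
qed

section \<open>Turan numbers and the Turan density\<close>

lemma free_subgraph: "free F H \<Longrightarrow> subgraph G H \<Longrightarrow> free F G"
  unfolding free_def subgraph_def by (meson in_mono order_trans)

lemma subconstruction_free: "turan_pair r F P \<Longrightarrow> subconstruction r P H \<Longrightarrow> free F H"
  unfolding subconstruction_def turan_pair_def using free_subgraph[of F _ H] by blast

text \<open>A supremum of naturals is usable once the set is bounded; here the number of all
  \<open>r\<close>-subsets is a bound.\<close>

lemma turan_ex_bounds:
  shows turan_ex_upper: "r_graph r H \<Longrightarrow> free F H \<Longrightarrow> card (edges H) \<le> turan_ex r (card (verts H)) F"
    and turan_ex_least: "(\<And>H. r_graph r H \<Longrightarrow> card (verts H) = n \<Longrightarrow> free F H \<Longrightarrow> card (edges H) \<le> B)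
      \<Longrightarrow> turan_ex r n F \<le> B"
proof -
  have bound: "card (edges H) \<le> card (verts H) choose r" if "r_graph r H" for H
  proof -
    have "card (edges H) \<le> card {e. e \<subseteq> verts H \<and> card e = r}"
      using that by (intro card_mono) (auto simp: r_graph_def)
    then show ?thesis using that by (simp add: r_graph_def n_subsets)
  qed
  show "card (edges H) \<le> turan_ex r (card (verts H)) F" if "r_graph r H" "free F H"
    unfolding turan_ex_def
  proof (rule cSup_upper)
    show "card (edges H) \<in> {card (edges G) |G. r_graph r G \<and> card (verts G) = card (verts H) \<and> free F G}"
      using that by blast
    show "bdd_above {card (edges G) |G. r_graph r G \<and> card (verts G) = card (verts H) \<and> free F G}"
      by (rule bdd_aboveI[of _ "card (verts H) choose r"]) (use bound in fastforce)
  qed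
  show "turan_ex r n F \<le> B"
    if "\<And>H. r_graph r H \<Longrightarrow> card (verts H) = n \<Longrightarrow> free F H \<Longrightarrow> card (edges H) \<le> B"
  proof (cases "{card (edges H) | H. r_graph r H \<and> card (verts H) = n \<and> free F H} = {}")
    \<comment> \<open>No hypergraph qualifies, and \<open>Sup {} = 0\<close>.\<close>
    case True
    show ?thesis unfolding turan_ex_def True by simp
  next
    case False
    then show ?thesis unfolding turan_ex_def by (rule cSup_least) (use that in auto)
  qed
qed

lemma sum_degree:
  assumes "r_graph r H"
  shows "(\<Sum>v\<in>verts H. degree H v) = r * card (edges H)"
proof -
  have fin: "finite (verts H)" "finite (edges H)"
    using assms r_graph_finite_edges[OF assms] by (auto simp: r_graph_def)
  have "(\<Sum>v\<in>verts H. degree H v) = (\<Sum>v\<in>verts H. \<Sum>e\<in>edges H. if v \<in> e then 1 else 0)"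
    using fin by (simp add: degree_def sum.If_cases Int_def)
  also have "\<dots> = (\<Sum>e\<in>edges H. \<Sum>v\<in>verts H. if v \<in> e then 1 else 0)"
    by (rule sum.swap)
  also have "\<dots> = (\<Sum>e\<in>edges H. r)"
  proof (rule sum.cong)
    fix e assume "e \<in> edges H"
    note e = r_graph_edgeD[OF assms this]
    have "verts H \<inter> e = e" using e by auto
    then show "(\<Sum>v\<in>verts H. if v \<in> e then 1 else 0) = r" using fin e by (simp add: sum.If_cases)
  qed auto
  finally show ?thesis by simp
qed

lemma remove_vertex_edges:
  assumes "r_graph r H"
  shows "card (edges (remove_vertex H v)) + degree H v = card (edges H)"
proof -
  have "edges H = {e \<in> edges H. v \<notin> e} \<union> {e \<in> edges H. v \<in> e}" by auto
  also have "card \<dots> = card {e \<in> edges H. v \<notin> e} + card {e \<in> edges H. v \<in> e}"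
    using r_graph_finite_edges[OF assms] by (intro card_Un_disjoint) auto
  finally show ?thesis by (simp add: remove_vertex_def degree_def)
qed

text \<open>Averaging over vertex deletions: summing |H - v| <= ex(n) over all v counts each edge
  once per vertex outside it, that is n + 1 - r times. If n + 1 <= r, truncated subtraction makes
  the left side 0.\<close>

lemma turan_ex_Suc:
  "turan_ex r (Suc n) F * (Suc n - r) \<le> Suc n * turan_ex r n F"
proof (cases "Suc n \<le> r")
  case False
  have *: "card (edges H) * (Suc n - r) \<le> Suc n * turan_ex r n F"
    if H: "r_graph r H" "card (verts H) = Suc n" "free F H" for H
  proof -
    have step: "card (edges H) \<le> turan_ex r n F + degree H v" if v: "v \<in> verts H" for v
    proof -
      have "r_graph r (remove_vertex H v)"
        using H(1) by (auto simp: r_graph_def remove_vertex_def)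
      moreover have "free F (remove_vertex H v)"
        by (rule free_subgraph[OF H(3)]) (auto simp: subgraph_def remove_vertex_def)
      moreover have "card (verts (remove_vertex H v)) = n"
        using H v by (simp add: remove_vertex_def r_graph_def)
      ultimately have "card (edges (remove_vertex H v)) \<le> turan_ex r n F"
        using turan_ex_upper by metis
      then show ?thesis using remove_vertex_edges[OF H(1), of v] by linarith
    qed
    have "Suc n * card (edges H) = (\<Sum>v\<in>verts H. card (edges H))" using H by simp
    also have "\<dots> \<le> (\<Sum>v\<in>verts H. turan_ex r n F + degree H v)" by (rule sum_mono) (rule step)
    also have "\<dots> = Suc n * turan_ex r n F + r * card (edges H)"
      using H(2) by (simp add: sum.distrib sum_degree[OF H(1)])
    finally show ?thesis by (simp add: diff_mult_distrib2 mult.commute[of "card (edges H)"] le_diff_conv)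
  qed
  have "card (edges H) \<le> Suc n * turan_ex r n F div (Suc n - r)"
    if "r_graph r H" "card (verts H) = Suc n" "free F H" for H
    using *[OF that] False by (simp add: less_eq_div_iff_mult_less_eq)
  then have "turan_ex r (Suc n) F \<le> Suc n * turan_ex r n F div (Suc n - r)"
    by (rule turan_ex_least)
  then show ?thesis using False by (simp add: less_eq_div_iff_mult_less_eq)
qed simp

lemma binomial_step: "r * (n choose r) = n * ((n - 1) choose (r - 1))" if "r \<ge> 1"
proof (cases n)
  case (Suc l)
  then show ?thesis using that Suc_times_binomial_eq[of l "r - 1"] by (simp add: mult.commute)
qed (use that in simp)

text \<open>The identity (n + 1 - r) binom(n + 1, r) = (n + 1) binom(n, r) turns the averaging bound
  into monotonicity. The computation stays in the naturals and cancels the factor (n + 1)(n + 1 -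
  r), positive since \<open>n \<ge> r\<close>.\<close>

lemma turan_ratio_Suc:
  assumes "n \<ge> r"
  shows "real (turan_ex r (Suc n) F) / real (Suc n choose r) \<le> real (turan_ex r n F) / real (n choose r)"
proof -
  have pos: "0 < Suc n choose r" "0 < n choose r" using assms by auto
  have "(Suc n - r) * (Suc n choose r) = Suc n * (n choose r)"
    using binomial_absorb_comp[of "Suc n" r] by simp
  then have "turan_ex r (Suc n) F * (n choose r) * (Suc n * (Suc n - r))
      = turan_ex r (Suc n) F * (Suc n - r) * ((Suc n - r) * (Suc n choose r))"
    by (simp only: mult_ac)
  also have "\<dots> \<le> Suc n * turan_ex r n F * ((Suc n - r) * (Suc n choose r))"
    by (rule mult_right_mono[OF turan_ex_Suc]) simp
  also have "\<dots> = turan_ex r n F * (Suc n choose r) * (Suc n * (Suc n - r))" by (simp only: mult_ac)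
  finally have "turan_ex r (Suc n) F * (n choose r) \<le> turan_ex r n F * (Suc n choose r)"
    using assms by (subst (asm) mult_le_cancel2) auto
  then have "real (turan_ex r (Suc n) F) * real (n choose r) \<le> real (turan_ex r n F) * real (Suc n choose r)"
    unfolding of_nat_mult[symmetric] of_nat_le_iff .
  then show ?thesis using pos by (simp add: divide_simps mult_ac del: binomial_Suc_Suc)
qed

text \<open>The shift by \<open>r\<close> skips the terms with denominator 0.\<close>

lemma turan_ratio_decseq: "decseq (\<lambda>n. real (turan_ex r (n + r) F) / real ((n + r) choose r))"
  using turan_ratio_Suc[of r "_ + r" F] by (intro decseq_SucI) (simp del: binomial_Suc_Suc)

text \<open>\<open>lim\<close> is informative only for convergent sequences. This one decreases and
  is bounded below by 0, and the shift does not change its limit.\<close>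

lemma turan_density_lim:
  "(\<lambda>n. real (turan_ex r (n + r) F) / real ((n + r) choose r)) \<longlonglongrightarrow> turan_density r F"
proof -
  let ?X = "\<lambda>n. real (turan_ex r n F) / real (n choose r)"
  obtain L where "(\<lambda>n. ?X (n + r)) \<longlonglongrightarrow> L"
    using decseq_convergent[OF turan_ratio_decseq, of 0 r F] by auto
  moreover from this have "?X \<longlonglongrightarrow> L" by (rule LIMSEQ_offset)
  ultimately show ?thesis by (simp add: turan_density_def limI)
qed

lemma turan_density_le_ratio: "n \<ge> r \<Longrightarrow> turan_density r F \<le> real (turan_ex r n F) / real (n choose r)"
  using decseq_ge[OF turan_ratio_decseq turan_density_lim, of r F "n - r"] by (simp only: le_add_diff_inverse2)

lemma turan_density_nonneg: "turan_density r F \<ge> 0"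
  by (rule LIMSEQ_le_const[OF turan_density_lim]) (intro exI allI impI divide_nonneg_nonneg of_nat_0_le_iff)

lemma turan_density_le_ex: "turan_density r F * real (n choose r) \<le> real (turan_ex r n F)"
proof (cases "n \<ge> r")
  case True
  then have "0 < n choose r" by simp
  then show ?thesis using turan_density_le_ratio[OF True, of F] by (simp add: field_simps)
qed (simp add: binomial_eq_0)

lemma turan_ex_le_density:
  assumes "\<sigma> > 0"
  shows "\<exists>N. \<forall>n\<ge>N. real (turan_ex r n F) \<le> (turan_density r F + \<sigma>) * real (n choose r)"
proof -
  have "\<forall>\<^sub>F n in sequentially. real (turan_ex r (n + r) F) / real ((n + r) choose r) < turan_density r F + \<sigma>"
    by (rule order_tendstoD[OF turan_density_lim]) (use assms in simp)
  then obtain N where N: "\<And>n. n \<ge> N \<Longrightarrow>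
      real (turan_ex r (n + r) F) / real ((n + r) choose r) < turan_density r F + \<sigma>"
    by (auto simp: eventually_sequentially)
  have "real (turan_ex r n F) \<le> (turan_density r F + \<sigma>) * real (n choose r)" if "n \<ge> N + r" for n
  proof -
    have "n choose r > 0" using that by simp
    moreover have "N \<le> n - r" "n - r + r = n" using that by auto
    ultimately show ?thesis using N[of "n - r"] by (simp add: field_simps)
  qed
  then show ?thesis by blast
qed

section \<open>Density strictly below 1\<close>

text \<open>An edgeless \<open>F\<close> would embed by the identity into the edgeless hypergraph on
  its own vertices, which is a subconstruction and hence \<open>F\<close>-free.\<close>

lemma turan_pair_edges_nonempty:
  assumes "is_pattern r P" "turan_pair r F P" "r_graph r F"
  shows "edges F \<noteq> {}"
proof
  assume "edges F = {}"
  have "1 \<in> fst P" using assms(1) by (auto simp: is_pattern_def)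
  then have "pattern_colouring P (\<lambda>_. 1) (verts F, {})" by (simp add: pattern_colouring_def)
  then have "subconstruction r P (verts F, {})"
    using assms by (intro colouring_imp_subconstruction) (auto simp: r_graph_def)
  then have "free F (verts F, {})" using assms(2) subconstruction_free by blast
  then show False using \<open>edges F = {}\<close> by (auto simp: free_def intro: inj_on_id)
qed

text \<open>The complete \<open>r\<close>-graph on as many vertices as \<open>F\<close> contains
  \<open>F\<close>, so already at this n the ratio is below 1; the ratios decrease to the
  density.\<close>

lemma turan_density_less_1:
  assumes "r_graph r F" "edges F \<noteq> {}"
  shows "turan_density r F < 1"
proof -
  let ?m = "card (verts F)"
  obtain e where e: "e \<in> edges F" using assms(2) by auto
  have finF: "finite (verts F)" using assms(1) by (simp add: r_graph_def)
  have rm: "r \<le> ?m" using r_graph_edgeD[OF assms(1) e] card_mono[OF finF] by metis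
  then have pos: "?m choose r > 0" by simp
  have "turan_ex r ?m F \<le> (?m choose r) - 1"
  proof (rule turan_ex_least)
    fix H assume H: "r_graph r H" "card (verts H) = ?m" "free F H"
    have finH: "finite (verts H)" using H by (simp add: r_graph_def)
    let ?K = "{X. X \<subseteq> verts H \<and> card X = r}"
    have finK: "finite ?K" using finH by auto
    have sub: "edges H \<subseteq> ?K" using H(1) by (auto simp: r_graph_def)
    obtain f where f: "bij_betw f (verts F) (verts H)"
      using finite_same_card_bij[OF finF finH] H(2) by metis
    have "edges H \<noteq> ?K"
    proof
      assume eq: "edges H = ?K"
      have "f ` e \<in> edges H" if "e \<in> edges F" for e
      proof -
        note e = r_graph_edgeD[OF assms(1) that]
        have "inj_on f e" using f e(1) by (meson bij_betw_def inj_on_subset)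
        then have "card (f ` e) = r" using e by (simp add: card_image)
        moreover have "f ` e \<subseteq> verts H" using e(1) f by (auto simp: bij_betw_def)
        ultimately show ?thesis using eq by auto
      qed
      moreover have "inj_on f (verts F)" "f ` verts F \<subseteq> verts H" using f by (auto simp: bij_betw_def)
      ultimately show False using H(3) unfolding free_def by blast
    qed
    then have "card (edges H) < card ?K" using sub finK by (meson psubset_card_mono psubsetI)
    then show "card (edges H) \<le> (?m choose r) - 1" using n_subsets[OF finH, of r] H(2) by simp
  qed
  then have "turan_ex r ?m F < ?m choose r" using pos by linarith
  then have "real (turan_ex r ?m F) / real (?m choose r) < 1" using pos by simp
  then show ?thesis using turan_density_le_ratio[OF rm, of F] by linarith
qed

section \<open>Cloning a vertex of a subconstruction\<close>

text \<open>Each clone receives the colour of \<open>u\<close>, so a copied edge has the same colour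
  multiset as its original. The enlarged hypergraph is again a subconstruction, hence
  \<open>F\<close>-free, and each clone adds \<open>degree G u\<close> new edges.\<close>

lemma subconstruction_clone_le_turan_ex:
  assumes "is_pattern r P" "turan_pair r F P" "r_graph r G" "subconstruction r P G" "u \<in> verts G"
  shows "card (edges G) + t * degree G u \<le> turan_ex r (card (verts G) + t) F"
proof -
  obtain f where f: "pattern_colouring P f G" using subconstruction_imp_colouring assms by blast
  let ?V = "verts G"
  have finV: "finite ?V" using assms(3) by (simp add: r_graph_def)
  then have "infinite (UNIV - ?V)" by (simp add: Diff_infinite_finite)
  from infinite_arbitrarily_large[OF this, of t]
  obtain T where T: "finite T" "card T = t" "T \<inter> ?V = {}" by blast
  define D where "D = {e \<in> edges G. u \<in> e}"
  \<comment> \<open>\<open>C x\<close> copies the edges at \<open>u\<close>, with the clone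
    \<open>x\<close> in place of \<open>u\<close>.\<close>
  define C where "C = (\<lambda>x. (\<lambda>e. insert x (e - {u})) ` D)"
  define G' where "G' = (?V \<union> T, edges G \<union> (\<Union>x\<in>T. C x))"
  define f' where "f' = (\<lambda>v. if v \<in> T then f u else f v)"
  have finE: "finite (edges G)" and finD: "finite D"
    using r_graph_finite_edges[OF assms(3)] by (auto simp: D_def)
  have e_T: "e \<inter> T = {}" if "e \<in> edges G" for e
    using r_graph_edgeD(1)[OF assms(3) that] T(3) by blast
  have f'_eq: "image_mset f' (mset_set A) = image_mset f (mset_set A)" if "finite A" "A \<inter> T = {}" for A
    using that by (intro image_mset_cong) (auto simp: f'_def)
  \<comment> \<open>Meeting \<open>T\<close> in exactly \<open>x\<close> is what makes the families
    \<open>C x\<close> disjoint from each other and from \<open>edges G\<close>.\<close>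
  have clone: "card X = r \<and> X \<subseteq> ?V \<union> T \<and> image_mset f' (mset_set X) \<in> snd P \<and> X \<inter> T = {x}"
    if X: "X \<in> C x" and x: "x \<in> T" for x X
  proof -
    obtain e where e: "e \<in> edges G" "u \<in> e" "X = insert x (e - {u})"
      using X by (auto simp: C_def D_def)
    note e' = r_graph_edgeD[OF assms(3) e(1)]
    have xe: "x \<notin> e" using e_T[OF e(1)] x by blast
    have "image_mset f' (mset_set X) = add_mset (f u) (image_mset f (mset_set (e - {u})))"
      using e(3) e'(3) xe x e_T[OF e(1)] f'_eq[of "e - {u}"] by (auto simp: f'_def)
    also have "\<dots> = image_mset f (mset_set e)"
      using e(2) e'(3) by (metis image_mset_add_mset mset_set.remove)
    finally have "image_mset f' (mset_set X) \<in> snd P" using f e(1) by (simp add: pattern_colouring_def)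
    moreover have "card X = r" using e e' xe card_Suc_Diff1[OF e'(3) e(2)] by (simp add: card_insert_if)
    ultimately show ?thesis using e(3) e' x e_T[OF e(1)] by auto
  qed
  have G'r: "r_graph r G'"
    unfolding r_graph_def G'_def using finV T(1) clone r_graph_edgeD[OF assms(3)] by auto
  moreover have "pattern_colouring P f' G'"
    unfolding pattern_colouring_def G'_def
    using f clone f'_eq r_graph_edgeD(3)[OF assms(3)] e_T
    by (auto simp: pattern_colouring_def f'_def[THEN fun_cong])
  ultimately have "free F G'"
    using colouring_imp_subconstruction subconstruction_free assms(1,2) by blast
  then have "card (edges G') \<le> turan_ex r (card ?V + t) F"
    using turan_ex_upper[OF G'r] T finV by (simp add: G'_def card_Un_disjoint Int_commute)
  moreover have cardC: "card (C x) = degree G u" if "x \<in> T" for x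
  proof -
    have "inj_on (\<lambda>e. insert x (e - {u})) D"
    proof (rule inj_onI)
      fix a b assume ab: "a \<in> D" "b \<in> D" "insert x (a - {u}) = insert x (b - {u})"
      then have "x \<notin> a" "x \<notin> b" "u \<in> a" "u \<in> b" using e_T that by (auto simp: D_def)
      then have "a = insert u (insert x (a - {u}) - {x})" "b = insert u (insert x (b - {u}) - {x})" by auto
      then show "a = b" using ab(3) by simp
    qed
    then show ?thesis by (simp add: C_def card_image D_def degree_def)
  qed
  have finC: "finite (C x)" for x using finD by (simp add: C_def)
  have disj: "C x \<inter> C y = {}" if "x \<in> T" "y \<in> T" "x \<noteq> y" for x y
  proof (rule equals0I)
    fix X assume "X \<in> C x \<inter> C y"
    then have "{x} = {y}" using clone[of X x] clone[of X y] that by simp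
    then show False using that by simp
  qed
  have "card (\<Union>x\<in>T. C x) = (\<Sum>x\<in>T. card (C x))"
    using T(1) finC disj by (intro card_UN_disjoint ballI impI)
  then have "card (\<Union>x\<in>T. C x) = t * degree G u" using cardC T(2) by simp
  moreover have "card (edges G') = card (edges G) + card (\<Union>x\<in>T. C x)"
  proof -
    have "edges G \<inter> (\<Union>x\<in>T. C x) = {}"
    proof (rule equals0I)
      fix X assume "X \<in> edges G \<inter> (\<Union>x\<in>T. C x)"
      then obtain x where "X \<in> edges G" "x \<in> T" "X \<in> C x" by blast
      then show False using clone[of X x] e_T[of X] by simp
    qed
    moreover have "finite (\<Union>x\<in>T. C x)" using T(1) finC by (intro finite_UN_I)
    ultimately show ?thesis unfolding G'_def snd_conv using finE by (intro card_Un_disjoint)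
  qed
  ultimately show ?thesis by simp
qed

section \<open>Binomial coefficients under a small linear increase of n\<close>

text \<open>Induction on \<open>s\<close> through (s + 1) binom(k, s + 1) = (k - s) binom(k, s);
  each step costs one more factor 1 + \<alpha>.\<close>

lemma binomial_add_le_mult:
  assumes "\<kappa> > (0::real)"
  shows "\<exists>\<gamma>>0. \<exists>N. \<forall>n\<ge>N. \<forall>t. real t \<le> \<gamma> * real n \<longrightarrow>
    real ((n + t) choose s) \<le> (1 + \<kappa>) * real (n choose s)"
  using assms
proof (induction s arbitrary: \<kappa>)
  case 0
  then show ?case by (intro exI[of _ 1]) auto
next
  case (Suc s)
  \<comment> \<open>Chosen so that (1 + \<alpha>)^2 <= 1 + 3 \<alpha> <= 1 + \<kappa>.\<close>
  define \<alpha> where "\<alpha> = min 1 \<kappa> / 3"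
  have \<alpha>: "\<alpha> > 0" "3 * \<alpha> \<le> 1" "3 * \<alpha> \<le> \<kappa>" using Suc.prems by (auto simp: \<alpha>_def)
  from Suc.IH[OF \<alpha>(1)] obtain \<gamma> N where \<gamma>: "\<gamma> > 0" and IH: "\<And>n t. n \<ge> N \<Longrightarrow> real t \<le> \<gamma> * real n \<Longrightarrow>
    real ((n + t) choose s) \<le> (1 + \<alpha>) * real (n choose s)" by blast
  have absorb: "real (Suc s) * real (k choose Suc s) = (real k - real s) * real (k choose s)" if "k \<ge> s" for k
  proof -
    have "Suc s * (k choose Suc s) = (k - s) * (k choose s)"
      using binomial_absorption[of s k] binomial_absorb_comp[of k s] by simp
    then have "real (Suc s * (k choose Suc s)) = real ((k - s) * (k choose s))" by (rule arg_cong)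
    then show ?thesis using that by (simp only: of_nat_mult of_nat_diff)
  qed
  \<comment> \<open>\<open>n \<ge> 2 * s\<close> gives n - s >= n / 2, so t <= \<alpha> n / 2 raises
    n - s by at most the factor 1 + \<alpha>.\<close>
  have "real ((n + t) choose Suc s) \<le> (1 + \<kappa>) * real (n choose Suc s)"
    if n: "n \<ge> max N (2 * s)" and t: "real t \<le> min \<gamma> (\<alpha> / 2) * real n" for n t
  proof -
    have "min \<gamma> (\<alpha> / 2) * real n \<le> \<gamma> * real n" "min \<gamma> (\<alpha> / 2) * real n \<le> \<alpha> / 2 * real n"
      by (rule mult_right_mono; simp)+
    then have t': "real t \<le> \<gamma> * real n" "real t \<le> \<alpha> * (real n / 2)" using t by auto
    have ns: "real n - real s \<ge> real n / 2" using n by (simp add: field_simps)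
    then have "\<alpha> * (real n / 2) \<le> \<alpha> * (real n - real s)" using \<alpha> by (intro mult_left_mono) auto
    then have t2: "real (n + t) - real s \<le> (1 + \<alpha>) * (real n - real s)"
      using t' by (simp add: algebra_simps)
    have "\<alpha> * \<alpha> \<le> \<alpha> * 1" by (rule mult_left_mono) (use \<alpha> in auto)
    moreover have "(1 + \<alpha>) * (1 + \<alpha>) = 1 + 2 * \<alpha> + \<alpha> * \<alpha>" by (simp add: algebra_simps)
    ultimately have "(1 + \<alpha>) * (1 + \<alpha>) \<le> 1 + \<kappa>" using \<alpha> by linarith
    have "real (Suc s) * real ((n + t) choose Suc s) = (real (n + t) - real s) * real ((n + t) choose s)"
      using n by (intro absorb) auto
    also have "\<dots> \<le> ((1 + \<alpha>) * (real n - real s)) * ((1 + \<alpha>) * real (n choose s))"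
      using t2 IH[of n t] t' n ns \<alpha> by (intro mult_mono) auto
    also have "\<dots> = ((1 + \<alpha>) * (1 + \<alpha>)) * ((real n - real s) * real (n choose s))" by (simp only: mult_ac)
    also have "\<dots> \<le> (1 + \<kappa>) * ((real n - real s) * real (n choose s))"
      using ns by (intro mult_right_mono \<open>(1 + \<alpha>) * (1 + \<alpha>) \<le> 1 + \<kappa>\<close>) (auto intro!: mult_nonneg_nonneg)
    also have "\<dots> = real (Suc s) * ((1 + \<kappa>) * real (n choose Suc s))"
      using absorb[of n] n by (simp add: mult_ac)
    finally show ?thesis by (subst (asm) mult_le_cancel_left_pos) auto
  qed
  then show ?case using \<gamma> \<alpha>(1)
    by (intro exI[of _ "min \<gamma> (\<alpha> / 2)"] conjI exI[of _ "max N (2 * s)"]) auto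
qed

text \<open>Add the \<open>t\<close> points one at a time: by Pascal's rule each creates at most
  binom(n - 1 + t, r - 1) new \<open>r\<close>-sets.\<close>

lemma binomial_add_le:
  assumes "r \<ge> 1" "n \<ge> 1"
  shows "(n + t) choose r \<le> (n choose r) + t * ((n - 1 + t) choose (r - 1))"
proof (induction t)
  case (Suc t)
  obtain q where q: "r = Suc q" using assms(1) by (cases r) auto
  have mono: "t * ((n - 1 + t) choose q) \<le> t * ((n + t) choose q)"
    by (intro mult_le_mono2 binomial_right_mono) simp
  have "n - 1 + Suc t = n + t" using assms(2) by simp
  then show ?case using Suc mono q by (simp only: add_Suc_right binomial_Suc_Suc diff_Suc_1 mult_Suc)
qed simp

lemma binomial_le_mult:
  assumes "r \<ge> 1"
  shows "n choose r \<le> n * ((n - 1) choose (r - 1))"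
proof -
  have "1 * (n choose r) \<le> r * (n choose r)" using assms by (intro mult_right_mono) auto
  then show ?thesis using binomial_step[OF assms, of n] by simp
qed

section \<open>Degrees in near-extremal subconstructions\<close>

text \<open>With A = binom(n, r), B = binom(n - 1, r - 1) and d the degree of u, cloning gives (p -
  \<sigma>) A + t d <= (p + \<sigma>) (A + t (1 + \<kappa>) B). Since A <= n B and t is linear in n,
  the error 2 \<sigma> A is a small part of t B, and division by t bounds d.\<close>

lemma subconstruction_degree_le:
  assumes "r \<ge> 1" "r_graph r F" "is_pattern r P" "turan_pair r F P" "\<eta> > 0"
  shows "\<exists>\<delta>>0. \<exists>N. \<forall>G n. r_graph r G \<and> subconstruction r P G \<and> card (verts G) = n \<and> n \<ge> N \<and>
      real (card (edges G)) \<ge> (turan_density r F - \<delta>) * real (n choose r) \<longrightarrow>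
      (\<forall>u\<in>verts G. real (degree G u) \<le> (turan_density r F + \<eta>) * real ((n - 1) choose (r - 1)))"
proof -
  let ?p = "turan_density r F"
  have p: "0 \<le> ?p" "?p < 1"
    using turan_density_nonneg turan_density_less_1 turan_pair_edges_nonempty assms by auto
  define \<kappa> where "\<kappa> = min 1 (\<eta> / 4)"
  have \<kappa>: "\<kappa> > 0" "\<kappa> \<le> 1" "\<kappa> \<le> \<eta> / 4" using assms(5) by (auto simp: \<kappa>_def)
  obtain \<gamma> N1 where \<gamma>: "\<gamma> > 0" and N1: "\<And>n t. n \<ge> N1 \<Longrightarrow> real t \<le> \<gamma> * real n \<Longrightarrow>
      real ((n + t) choose (r - 1)) \<le> (1 + \<kappa>) * real (n choose (r - 1))"
    using binomial_add_le_mult[OF \<kappa>(1), of "r - 1"] by blast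
  \<comment> \<open>One \<sigma> serves as edge deficit of \<open>G\<close> and as excess of ex over
    the density. The bound \<eta> \<gamma> / 32 makes 2 \<sigma> n <= t \<eta> / 4; with \<kappa> <=
    \<eta> / 4, the bound \<eta> / 8 keeps (p + \<sigma>)(1 + \<kappa>) below p + \<eta> /
    2.\<close>
  define \<sigma> where "\<sigma> = min (\<eta> / 8) (\<eta> * \<gamma> / 32)"
  have \<sigma>: "\<sigma> > 0" "\<sigma> \<le> \<eta> / 8" "\<sigma> \<le> \<eta> * \<gamma> / 32" using assms(5) \<gamma> by (auto simp: \<sigma>_def)
  obtain N2 where N2: "\<And>n. n \<ge> N2 \<Longrightarrow> real (turan_ex r n F) \<le> (?p + \<sigma>) * real (n choose r)"
    using turan_ex_le_density[OF \<sigma>(1)] by blast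
  \<comment> \<open>\<open>Suc N1\<close> because the binomial estimate is used at n - 1; the last
    term gives \<gamma> (n - 1) >= 2, so rounding down to \<open>t\<close> loses at most
    half.\<close>
  define N where "N = Suc N1 + N2 + 2 + nat \<lceil>2 / \<gamma>\<rceil>"
  have main: "real (degree G u) \<le> (?p + \<eta>) * real ((n - 1) choose (r - 1))"
    if G: "r_graph r G" "subconstruction r P G" "card (verts G) = n" "n \<ge> N"
      "real (card (edges G)) \<ge> (?p - \<sigma>) * real (n choose r)" and u: "u \<in> verts G" for G n u
  proof -
    have n: "n - 1 \<ge> N1" "n \<ge> N2" "n \<ge> 2" using G(4) by (auto simp: N_def)
    have "2 / \<gamma> \<le> real (n - 1)" using G(4) unfolding N_def by linarith
    then have n\<gamma>: "2 \<le> \<gamma> * real (n - 1)" using \<gamma> by (simp only: pos_divide_le_eq mult.commute)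
    define t where "t = nat \<lfloor>\<gamma> * real (n - 1)\<rfloor>"
    have t: "real t \<le> \<gamma> * real (n - 1)" "real t > \<gamma> * real (n - 1) - 1"
      using n\<gamma> unfolding t_def by linarith+
    have "\<gamma> * real n \<le> \<gamma> * (2 * real (n - 1))" using n \<gamma> by (intro mult_left_mono) auto
    then have t4: "\<gamma> * real n \<le> 4 * real t" and t0: "real t > 0" using t n\<gamma> by linarith+
    define A where "A = real (n choose r)"
    define B where "B = real ((n - 1) choose (r - 1))"
    define d where "d = real (degree G u)"
    have B0: "B \<ge> 0" by (simp add: B_def)
    have "real (n choose r) \<le> real (n * ((n - 1) choose (r - 1)))"
      using binomial_le_mult[OF assms(1)] by (simp only: of_nat_le_iff)
    then have AB: "A \<le> real n * B" by (simp add: A_def B_def)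
    have "real (card (edges G) + t * degree G u) \<le> real (turan_ex r (n + t) F)"
      using subconstruction_clone_le_turan_ex[OF assms(3,4) G(1,2) u, of t] G(3) by (simp only: of_nat_le_iff)
    also have "\<dots> \<le> (?p + \<sigma>) * real ((n + t) choose r)" using n by (intro N2) auto
    also have "\<dots> \<le> (?p + \<sigma>) * (A + real t * ((1 + \<kappa>) * B))"
    proof (rule mult_left_mono)
      have "real ((n + t) choose r) \<le> real ((n choose r) + t * ((n - 1 + t) choose (r - 1)))"
        using binomial_add_le[OF assms(1), of n t] n by (simp only: of_nat_le_iff)
      also have "\<dots> = A + real t * real ((n - 1 + t) choose (r - 1))" by (simp add: A_def)
      also have "\<dots> \<le> A + real t * ((1 + \<kappa>) * B)"
        using N1[OF n(1) t(1)] by (intro add_left_mono mult_left_mono) (auto simp: B_def)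
      finally show "real ((n + t) choose r) \<le> A + real t * ((1 + \<kappa>) * B)" .
    qed (use p \<sigma> in auto)
    finally have "(?p - \<sigma>) * A + real t * d \<le> (?p + \<sigma>) * (A + real t * ((1 + \<kappa>) * B))"
      using G(5) by (simp add: A_def d_def)
    then have "real t * d \<le> 2 * \<sigma> * A + real t * ((?p + \<sigma>) * (1 + \<kappa>) * B)"
      by (simp add: algebra_simps)
    also have "2 * \<sigma> * A \<le> 2 * \<sigma> * (real n * B)" using AB \<sigma> by simp
    also have "\<dots> = (2 * \<sigma> * real n) * B" by simp
    also have "\<dots> \<le> (real t * (\<eta> / 4)) * B"
    proof (rule mult_right_mono[OF _ B0])
      have "2 * \<sigma> * real n \<le> 2 * (\<eta> * \<gamma> / 32) * real n" using \<sigma> by (intro mult_right_mono) auto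
      also have "\<dots> = \<eta> / 16 * (\<gamma> * real n)" by simp
      also have "\<dots> \<le> \<eta> / 16 * (4 * real t)" using t4 assms(5) by (intro mult_left_mono) auto
      finally show "2 * \<sigma> * real n \<le> real t * (\<eta> / 4)" by (simp add: mult.commute)
    qed
    finally have "real t * d \<le> real t * ((\<eta> / 4 + (?p + \<sigma>) * (1 + \<kappa>)) * B)"
      by (simp add: algebra_simps)
    then have "d \<le> (\<eta> / 4 + (?p + \<sigma>) * (1 + \<kappa>)) * B" using t0 by simp
    also have "\<dots> \<le> (?p + \<eta>) * B"
    proof (rule mult_right_mono[OF _ B0])
      have "?p * \<kappa> \<le> 1 * \<kappa>" using p \<kappa> by (intro mult_right_mono) auto
      moreover have "\<sigma> * \<kappa> \<le> \<sigma> * 1" using \<kappa> \<sigma> by (intro mult_left_mono) auto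
      moreover have "(?p + \<sigma>) * (1 + \<kappa>) = ?p + \<sigma> + ?p * \<kappa> + \<sigma> * \<kappa>" by (simp add: algebra_simps)
      ultimately show "\<eta> / 4 + (?p + \<sigma>) * (1 + \<kappa>) \<le> ?p + \<eta>" using \<kappa> \<sigma> by linarith
    qed
    finally show ?thesis by (simp add: d_def B_def)
  qed
  show ?thesis by (intro exI[of _ \<sigma>] conjI exI[of _ N] \<sigma>(1)) (use main in blast)
qed

section \<open>Vertex-extendability implies its weak form\<close>

lemma edges_ge_of_min_degree:
  assumes "r \<ge> 1" "r_graph r H" "card (verts H) = n" "n \<ge> 1"
    and "real (min_degree H) \<ge> a * real ((n - 1) choose (r - 1))"
  shows "real (card (edges H)) \<ge> a * real (n choose r)"
proof -
  have fin: "finite (verts H)" using assms(2) by (simp add: r_graph_def)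
  have deg: "a * real ((n - 1) choose (r - 1)) \<le> real (degree H v)" if "v \<in> verts H" for v
  proof -
    have "min_degree H \<le> degree H v" unfolding min_degree_def using fin that by (intro Min_le) auto
    then show ?thesis using assms(5) by linarith
  qed
  have "real r * (a * real (n choose r)) = a * real (r * (n choose r))" by simp
  also have "\<dots> = (\<Sum>v\<in>verts H. a * real ((n - 1) choose (r - 1)))"
    unfolding binomial_step[OF assms(1)] using assms(3) by simp
  also have "\<dots> \<le> (\<Sum>v\<in>verts H. real (degree H v))" by (rule sum_mono) (rule deg)
  also have "\<dots> = real r * real (card (edges H))"
    using sum_degree[OF assms(2)] by (simp only: of_nat_sum[symmetric] of_nat_mult)
  finally show ?thesis using assms(1) by simp
qed

text \<open>Extendability makes \<open>H\<close> itself a subconstruction, and its minimum degree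
  makes it near-extremal, so the cloning bound applies to every vertex, \<open>v\<close>
  included.\<close>

lemma vertex_extendable_imp_weakly:
  assumes "r \<ge> 1" "r_graph r F" "is_pattern r P" "turan_pair r F P" "vertex_extendable r F P"
  shows "weakly_vertex_extendable r F P"
  unfolding weakly_vertex_extendable_def
proof (intro allI impI)
  fix \<delta> :: real assume "\<delta> > 0"
  let ?p = "turan_density r F"
  obtain N0 \<zeta> where \<zeta>: "\<zeta> > 0" and VE: "\<And>H v. \<lbrakk>r_graph r H; free F H; card (verts H) \<ge> N0;
      real (min_degree H) \<ge> (?p - \<zeta>) * real ((card (verts H) - 1) choose (r - 1));
      v \<in> verts H; subconstruction r P (remove_vertex H v)\<rbrakk> \<Longrightarrow> subconstruction r P H"
    using assms(5) unfolding vertex_extendable_def by blast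
  obtain \<delta>' N1 where \<delta>': "\<delta>' > 0" and N1: "\<And>G u. \<lbrakk>r_graph r G; subconstruction r P G;
      card (verts G) \<ge> N1; real (card (edges G)) \<ge> (?p - \<delta>') * real (card (verts G) choose r); u \<in> verts G\<rbrakk>
      \<Longrightarrow> real (degree G u) \<le> (?p + \<delta>) * real ((card (verts G) - 1) choose (r - 1))"
    using subconstruction_degree_le[OF assms(1-4) \<open>\<delta> > 0\<close>] by blast
  \<comment> \<open>In \<open>min \<zeta> \<delta>'\<close>, \<zeta> triggers extendability and
    \<delta>' the cloning bound.\<close>
  have main: "real (degree H v) \<le> (?p + \<delta>) * real ((n - 1) choose (r - 1))"
    if H: "r_graph r H" "free F H" "card (verts H) = n" "n \<ge> max (max N0 N1) 1"
      "real (min_degree H) \<ge> (?p - min \<zeta> \<delta>') * real ((n - 1) choose (r - 1))"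
      and v: "v \<in> verts H" "subconstruction r P (remove_vertex H v)" for H n v
  proof -
    have "(?p - min \<zeta> \<delta>') * real ((n - 1) choose (r - 1)) \<ge> (?p - \<zeta>) * real ((n - 1) choose (r - 1))"
      by (rule mult_right_mono) auto
    then have sub: "subconstruction r P H" using VE[of H v] H v by auto
    have "real (card (edges H)) \<ge> (?p - min \<zeta> \<delta>') * real (n choose r)"
      using edges_ge_of_min_degree[OF assms(1) H(1,3) _ H(5)] H(4) by simp
    moreover have "(?p - min \<zeta> \<delta>') * real (n choose r) \<ge> (?p - \<delta>') * real (n choose r)"
      by (rule mult_right_mono) auto
    ultimately show ?thesis using N1[of H v] H sub v by auto
  qed
  show "\<exists>N\<^sub>0. \<exists>\<zeta>>0. \<forall>H n. r_graph r H \<and> free F H \<and> card (verts H) = n \<and> n \<ge> N\<^sub>0 \<and>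
             real (min_degree H) \<ge> (?p - \<zeta>) * real ((n - 1) choose (r - 1))
           \<longrightarrow> (\<forall>v\<in>verts H. subconstruction r P (remove_vertex H v) \<longrightarrow>
                  real (degree H v) \<le> (?p + \<delta>) * real ((n - 1) choose (r - 1)))"
    using main \<zeta> \<delta>' by (intro exI[of _ "max (max N0 N1) 1"] exI[of _ "min \<zeta> \<delta>'"]) auto
qed

section \<open>Cost of deleting vertices, and the number of low-degree vertices\<close>

text \<open>For each z in \<open>Z\<close> at most binom(n - 2, r - 2) sets contain both u and z,
  and (n - 1) binom(n - 2, r - 2) = (r - 1) binom(n - 1, r - 1). Multiplying by n - 1 avoids
  division.\<close>

lemma card_edges_meeting:
  assumes "r \<ge> 1" "r_graph r G" "u \<in> verts G" "Z \<subseteq> verts G" "u \<notin> Z"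
  shows "card {e \<in> edges G. u \<in> e \<and> e \<inter> Z \<noteq> {}} * (card (verts G) - 1)
    \<le> card Z * (r - 1) * ((card (verts G) - 1) choose (r - 1))"
proof -
  let ?V = "verts G" let ?n = "card (verts G)"
  define K where "K = (\<lambda>z. {e. e \<subseteq> ?V \<and> card e = r \<and> u \<in> e \<and> z \<in> e})"
  have finV: "finite ?V" using assms(2) by (simp add: r_graph_def)
  have finZ: "finite Z" using finite_subset[OF assms(4) finV] .
  have finK: "finite (K z)" for z using finV by (simp add: K_def)
  have bound: "card (K z) * (?n - 1) \<le> (r - 1) * ((?n - 1) choose (r - 1))" if z: "z \<in> Z" for z
  proof -
    have uz: "u \<noteq> z" "{u, z} \<subseteq> ?V" using z assms by auto
    show ?thesis
    proof (cases "r \<ge> 2")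
      case False
      \<comment> \<open>Here \<open>r = 1\<close>, and no edge holds two vertices.\<close>
      have "K z = {}"
      proof (rule equals0I)
        fix e assume e: "e \<in> K z"
        then have "card {u, z} \<le> card e"
          using finite_subset[OF _ finV] by (intro card_mono) (auto simp: K_def)
        then show False using uz e False by (auto simp: K_def)
      qed
      then show ?thesis by simp
    next
      case True
      then obtain q where q: "r = Suc (Suc q)" by (metis add_2_eq_Suc le_Suc_ex)
      have "?n \<ge> 2" using card_mono[OF finV uz(2)] uz(1) by simp
      then obtain k where k: "?n = Suc (Suc k)" by (metis add_2_eq_Suc le_Suc_ex)
      have "K z \<subseteq> (\<lambda>X. insert u (insert z X)) ` {X. X \<subseteq> ?V - {u, z} \<and> card X = q}"
      proof
        fix e assume e: "e \<in> K z"
        have "card (e - {u, z}) = q"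
          using e uz q finite_subset[OF _ finV, of e] by (subst card_Diff_subset) (auto simp: K_def)
        moreover have "e = insert u (insert z (e - {u, z}))" using e by (auto simp: K_def)
        ultimately show "e \<in> (\<lambda>X. insert u (insert z X)) ` {X. X \<subseteq> ?V - {u, z} \<and> card X = q}"
          using e by (auto simp: K_def intro!: image_eqI[of _ _ "e - {u, z}"])
      qed
      then have "card (K z) \<le> card {X. X \<subseteq> ?V - {u, z} \<and> card X = q}"
        using finV by (intro surj_card_le) auto
      also have "\<dots> = k choose q"
        using uz finV k by (subst n_subsets) (auto simp: card_Diff_subset)
      finally have "card (K z) * Suc k \<le> (k choose q) * Suc k" by (rule mult_le_mono1)
      also have "\<dots> = Suc q * (Suc k choose Suc q)"
        using Suc_times_binomial_eq[of k q] by (simp add: mult.commute)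
      finally show ?thesis using k q by simp
    qed
  qed
  have "{e \<in> edges G. u \<in> e \<and> e \<inter> Z \<noteq> {}} \<subseteq> (\<Union>z\<in>Z. K z)"
    using r_graph_edgeD[OF assms(2)] by (auto simp: K_def)
  then have "card {e \<in> edges G. u \<in> e \<and> e \<inter> Z \<noteq> {}} \<le> card (\<Union>z\<in>Z. K z)"
    using finZ finK by (intro card_mono) auto
  also have "\<dots> \<le> (\<Sum>z\<in>Z. card (K z))" by (rule card_UN_le[OF finZ])
  finally have "card {e \<in> edges G. u \<in> e \<and> e \<inter> Z \<noteq> {}} * (?n - 1) \<le> (\<Sum>z\<in>Z. card (K z)) * (?n - 1)"
    by (rule mult_le_mono1)
  also have "\<dots> = (\<Sum>z\<in>Z. card (K z) * (?n - 1))" by (rule sum_distrib_right)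
  also have "\<dots> \<le> (\<Sum>z\<in>Z. (r - 1) * ((?n - 1) choose (r - 1)))" by (rule sum_mono) (rule bound)
  finally show ?thesis by (simp add: mult.assoc)
qed

text \<open>Degree sum: vertices outside \<open>Z\<close> exceed the level \<open>a\<close> by at
  most \<eta>, those in \<open>Z\<close> fall short by \<theta>, and the average falls short by at
  most \<delta>. A large \<open>Z\<close> would violate this.\<close>

lemma card_low_degree:
  assumes "r \<ge> 1" "r_graph r G" "card (verts G) = n" "n \<ge> r" "\<eta> \<ge> 0"
    and "real (card (edges G)) \<ge> (a - \<delta>) * real (n choose r)"
    and "\<And>u. u \<in> verts G \<Longrightarrow> real (degree G u) \<le> (a + \<eta>) * real ((n - 1) choose (r - 1))"
    and "Z \<subseteq> verts G" "\<And>u. u \<in> Z \<Longrightarrow> real (degree G u) \<le> (a - \<theta>) * real ((n - 1) choose (r - 1))"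
  shows "real (card Z) * \<theta> \<le> (\<delta> + \<eta>) * real n"
proof -
  have finV: "finite (verts G)" using assms(2) by (simp add: r_graph_def)
  define B where "B = real ((n - 1) choose (r - 1))"
  have B: "B > 0" using assms(1,4) by (simp add: B_def)
  have "(a - \<delta>) * real n * B = (a - \<delta>) * real (r * (n choose r))"
    unfolding binomial_step[OF assms(1)] by (simp add: B_def)
  also have "\<dots> = real r * ((a - \<delta>) * real (n choose r))" by simp
  also have "\<dots> \<le> real r * real (card (edges G))" using assms(6) by (intro mult_left_mono) auto
  also have "\<dots> = (\<Sum>v\<in>verts G. real (degree G v))"
    using sum_degree[OF assms(2)] by (simp only: of_nat_sum[symmetric] of_nat_mult)
  also have "\<dots> = (\<Sum>v\<in>Z. real (degree G v)) + (\<Sum>v\<in>verts G - Z. real (degree G v))"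
    by (subst sum.subset_diff[OF assms(8) finV]) simp
  also have "\<dots> \<le> (\<Sum>v\<in>Z. (a - \<theta>) * B) + (\<Sum>v\<in>verts G - Z. (a + \<eta>) * B)"
    using assms(7,9) by (intro add_mono sum_mono) (auto simp: B_def)
  also have "\<dots> = (real (card Z) * (a - \<theta>) + (real n - real (card Z)) * (a + \<eta>)) * B"
    using assms(3,8) finV card_mono[OF finV assms(8)] finite_subset[OF assms(8) finV]
    by (simp add: card_Diff_subset of_nat_diff algebra_simps)
  finally have "(a - \<delta>) * real n \<le> real (card Z) * (a - \<theta>) + (real n - real (card Z)) * (a + \<eta>)"
    using B by simp
  moreover have "real (card Z) * \<eta> \<ge> 0" using assms(5) by simp
  ultimately show ?thesis by (simp add: algebra_simps)
qed

section \<open>The degree bound for near-extremal F-free hypergraphs\<close>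

lemma weakly_vertex_extendable_degree_le:
  assumes "r \<ge> 1" "r_graph r F" "is_pattern r P" "turan_pair r F P" "edge_stable r F P"
    "weakly_vertex_extendable r F P" "\<epsilon> > 0"
  shows "\<exists>c>0. \<exists>N. \<forall>H n. r_graph r H \<and> free F H \<and> card (verts H) = n \<and> n \<ge> N \<and>
      real (card (edges H)) \<ge> (turan_density r F - c) * real (n choose r) \<longrightarrow>
      (\<forall>v\<in>verts H. real (degree H v) \<le> (turan_density r F + \<epsilon>) * real ((n - 1) choose (r - 1)))"
proof -
  let ?p = "turan_density r F"
  have p: "0 \<le> ?p" by (rule turan_density_nonneg)
  \<comment> \<open>Only \<epsilon> / 2 is spent here; the other half pays for the edges lost at
    \<open>v\<close>.\<close>
  obtain N1 \<zeta> where \<zeta>: "\<zeta> > 0" and WVE: "\<And>H v. \<lbrakk>r_graph r H; free F H; card (verts H) \<ge> N1;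
      real (min_degree H) \<ge> (?p - \<zeta>) * real ((card (verts H) - 1) choose (r - 1));
      v \<in> verts H; subconstruction r P (remove_vertex H v)\<rbrakk> \<Longrightarrow>
      real (degree H v) \<le> (?p + \<epsilon> / 2) * real ((card (verts H) - 1) choose (r - 1))"
    using assms(6) assms(7)[THEN half_gt_zero] unfolding weakly_vertex_extendable_def by blast
  \<comment> \<open>\<rho> B bounds the degree lost by deletion, \<mu> n the number of deleted
    vertices, and p - \<theta> marks low degree. Then \<theta> + \<rho> <= \<zeta> preserves the
    minimum degree, and \<mu> <= 1 / 2 keeps half of the vertices.\<close>
  define \<rho> where "\<rho> = min (\<zeta> / 2) (\<epsilon> / 2)"
  define \<mu> where "\<mu> = min (1 / 2) (\<rho> / (4 * real r))"
  define \<theta> where "\<theta> = \<zeta> / 2"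
  have \<rho>: "\<rho> > 0" "\<rho> \<le> \<zeta> / 2" "\<rho> \<le> \<epsilon> / 2" and \<theta>: "\<theta> > 0"
    using \<zeta> assms(7) by (auto simp: \<rho>_def \<theta>_def)
  have \<mu>: "\<mu> > 0" "\<mu> \<le> 1 / 2" using \<rho> assms(1) by (auto simp: \<mu>_def)
  have "\<mu> \<le> \<rho> / (4 * real r)" by (simp add: \<mu>_def)
  then have \<mu>r: "4 * \<mu> * real r \<le> \<rho>" using assms(1) by (simp add: pos_le_divide_eq mult_ac)
  have \<theta>\<mu>: "\<theta> * \<mu> / 2 > 0" using \<theta> \<mu> by simp
  obtain \<delta>' N2 where \<delta>': "\<delta>' > 0" and N2: "\<And>G u. \<lbrakk>r_graph r G; subconstruction r P G;
      card (verts G) \<ge> N2; real (card (edges G)) \<ge> (?p - \<delta>') * real (card (verts G) choose r); u \<in> verts G\<rbrakk>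
      \<Longrightarrow> real (degree G u) \<le> (?p + \<theta> * \<mu> / 2) * real ((card (verts G) - 1) choose (r - 1))"
    using subconstruction_degree_le[OF assms(1-4) \<theta>\<mu>] by blast
  \<comment> \<open>Deficit and excess of at most \<theta> \<mu> / 2 each give |Z| \<theta> <=
    \<theta> \<mu> n.\<close>
  define \<delta> where "\<delta> = min \<delta>' (\<theta> * \<mu> / 2)"
  have \<delta>: "\<delta> > 0" "\<delta> \<le> \<delta>'" "\<delta> \<le> \<theta> * \<mu> / 2" using \<delta>' \<theta>\<mu> by (auto simp: \<delta>_def)
  obtain N0 c where c: "c > 0" and ES: "\<And>H. \<lbrakk>r_graph r H; free F H; card (verts H) \<ge> N0;
      real (card (edges H)) \<ge> (?p - c) * real (card (verts H) choose r)\<rbrakk> \<Longrightarrow>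
      \<exists>G. r_graph r G \<and> subgraph G H \<and> subconstruction r P G \<and>
        real (card (edges G)) \<ge> (?p - \<delta>) * real (card (verts H) choose r)"
    using assms(5) \<delta>(1) unfolding edge_stable_def by blast
  \<comment> \<open>\<open>2 * N1\<close> since the hypergraph passed to weak extendability keeps at
    least n / 2 vertices; \<open>1 / \<mu>\<close> lets \<mu> n absorb the single extra vertex
    \<open>v\<close>.\<close>
  define N where "N = N0 + N2 + 2 * N1 + 2 + r + nat \<lceil>1 / \<mu>\<rceil>"
  have main: "real (degree H v) \<le> (?p + \<epsilon>) * real ((n - 1) choose (r - 1))"
    if H: "r_graph r H" "free F H" "card (verts H) = n" "n \<ge> N"
      "real (card (edges H)) \<ge> (?p - c) * real (n choose r)" and v: "v \<in> verts H" for H n v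
  proof (rule ccontr)
    define B where "B = real ((n - 1) choose (r - 1))"
    \<comment> \<open>The assumed excess also ensures that \<open>v\<close> itself meets the minimum
      degree condition later.\<close>
    assume "\<not> ?thesis"
    then have vdeg: "real (degree H v) > (?p + \<epsilon>) * B" by (simp add: B_def)
    let ?V = "verts H"
    have finV: "finite ?V" using H(1) by (simp add: r_graph_def)
    have n: "n \<ge> N0" "n \<ge> N2" "n \<ge> 2 * N1" "n \<ge> 2" "n \<ge> r" using H(4) by (auto simp: N_def)
    have "1 / \<mu> \<le> real n" using H(4) unfolding N_def by linarith
    then have n\<mu>: "1 \<le> \<mu> * real n" using \<mu> by (simp add: pos_divide_le_eq mult.commute)
    have B0: "B > 0" using n assms(1) by (simp add: B_def)
    obtain G0 where G0: "r_graph r G0" "subgraph G0 H" "subconstruction r P G0"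
        "real (card (edges G0)) \<ge> (?p - \<delta>) * real (n choose r)"
      using ES[OF H(1,2)] H n by auto
    \<comment> \<open>\<open>G0\<close> may miss vertices of \<open>H\<close>; adding them as
      isolated vertices makes the degree bounds refer to n.\<close>
    define G where "G = (?V, edges G0)"
    have vG: "verts G = ?V" and eG: "edges G = edges G0" by (simp_all add: G_def)
    have GH: "edges G \<subseteq> edges H" using G0(2) by (simp add: eG subgraph_def)
    have Gr: "r_graph r G" using H(1) GH unfolding r_graph_def vG by blast
    obtain f where f: "pattern_colouring P f G0" using subconstruction_imp_colouring assms(3) G0 by blast
    then have Gsub: "subconstruction r P G"
      using colouring_imp_subconstruction[OF assms(3) Gr] by (simp add: pattern_colouring_def G_def)
    have "(?p - \<delta>') * real (n choose r) \<le> (?p - \<delta>) * real (n choose r)"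
      by (rule mult_right_mono) (use \<delta> in auto)
    then have "(?p - \<delta>') * real (n choose r) \<le> real (card (edges G0))" using G0(4) by (rule order.trans)
    then have Gdeg: "real (degree G u) \<le> (?p + \<theta> * \<mu> / 2) * B" if "u \<in> ?V" for u
      using N2[OF Gr Gsub] n H(3) that by (simp add: vG eG B_def)
    \<comment> \<open>\<open>v\<close> is kept even if its degree in \<open>G\<close> is low, since
      its edges will come from \<open>H\<close>.\<close>
    define Z where "Z = {u \<in> ?V. u \<noteq> v \<and> real (degree G u) \<le> (?p - \<theta>) * B}"
    have Z: "Z \<subseteq> ?V" "v \<notin> Z" by (auto simp: Z_def)
    have finZ: "finite Z" using finite_subset[OF Z(1) finV] .
    have "real (card Z) * \<theta> \<le> (\<delta> + \<theta> * \<mu> / 2) * real n"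
      using assms(1) Gr H(3) n(5) \<theta>\<mu> G0(4) Gdeg Z(1)
      by (intro card_low_degree[of r G n _ ?p]) (auto simp: vG eG B_def Z_def)
    also have "\<dots> \<le> (\<theta> * \<mu>) * real n" using \<delta> by (intro mult_right_mono) auto
    finally have "real (card Z) * \<theta> \<le> \<mu> * real n * \<theta>" by (simp add: mult_ac)
    then have cardZ: "real (card Z) \<le> \<mu> * real n" using \<theta> by simp
    also have "\<dots> \<le> 1 / 2 * real n" using \<mu> by (intro mult_right_mono) auto
    finally have halfZ: "2 * card Z \<le> n" by linarith
    \<comment> \<open>|Y| <= |Z| + 1 <= 2 \<mu> n <= 4 \<mu> (n - 1), and 4 \<mu> r <= \<rho>. It is
      used for \<open>H\<close> at \<open>v\<close> with \<open>Y = Z\<close>, and for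
      \<open>G\<close> elsewhere with \<open>Y = insert v Z\<close>.\<close>
    have loss: "real (card {e \<in> edges K. u \<in> e \<and> e \<inter> Y \<noteq> {}}) \<le> \<rho> * B"
      if K: "r_graph r K" "verts K = ?V" and u: "u \<in> ?V" "u \<notin> Y" and Y: "Y \<subseteq> insert v Z" for K u Y
    proof -
      let ?x = "card {e \<in> edges K. u \<in> e \<and> e \<inter> Y \<noteq> {}}"
      have "card Y \<le> card (insert v Z)" using Y finZ by (intro card_mono) auto
      then have "real (card Y) \<le> real (card Z) + 1" using finZ Z by simp
      moreover have "\<mu> * real n \<le> \<mu> * (2 * real (n - 1))" using n \<mu> by (intro mult_left_mono) auto
      ultimately have Yn: "real (card Y) \<le> 4 * \<mu> * real (n - 1)" using cardZ n\<mu> by linarith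
      have "?x * (n - 1) \<le> card Y * (r - 1) * ((n - 1) choose (r - 1))"
        using card_edges_meeting[OF assms(1) K(1), of u Y] K u Y Z v H(3) by auto
      then have "real (?x * (n - 1)) \<le> real (card Y * (r - 1) * ((n - 1) choose (r - 1)))"
        by (simp only: of_nat_le_iff)
      then have "real ?x * real (n - 1) \<le> real (card Y) * real (r - 1) * B" by (simp only: of_nat_mult B_def)
      also have "\<dots> \<le> (4 * \<mu> * real (n - 1)) * real r * B"
        using Yn B0 \<mu> by (intro mult_mono) auto
      also have "\<dots> = (4 * \<mu> * real r) * (real (n - 1) * B)" by (simp only: mult_ac)
      also have "\<dots> \<le> \<rho> * (real (n - 1) * B)" using \<mu>r B0 by (intro mult_right_mono) auto
      finally have "real ?x * real (n - 1) \<le> (\<rho> * B) * real (n - 1)" by (simp only: mult_ac)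
      then show ?thesis by (rule mult_right_le_imp_le) (use n in simp)
    qed
    \<comment> \<open>\<open>Q\<close> lies in \<open>H\<close>, so it is \<open>F\<close>-free;
      without \<open>v\<close> only edges of \<open>G\<close> remain, so \<open>f\<close> still
      colours it.\<close>
    define Q where "Q = (?V - Z, {e \<in> edges G. v \<notin> e \<and> e \<inter> Z = {}} \<union> {e \<in> edges H. v \<in> e \<and> e \<inter> Z = {}})"
    have Qr: "r_graph r Q" using H(1) GH by (fastforce simp: r_graph_def Q_def)
    have QH: "subgraph Q H" using GH by (auto simp: subgraph_def Q_def)
    have finQ: "finite (edges Q)" by (rule r_graph_finite_edges[OF Qr])
    have vQ: "v \<in> verts Q" using v Z by (simp add: Q_def)
    have cardQ: "card (verts Q) = n - card Z" using Z H(3) finZ by (simp add: Q_def card_Diff_subset)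
    define B' where "B' = real ((card (verts Q) - 1) choose (r - 1))"
    have B': "B' \<ge> 0" "B' \<le> B" using cardQ by (auto simp: B'_def B_def intro: binomial_right_mono)
    have "r_graph r (remove_vertex Q v)" using Qr by (auto simp: r_graph_def remove_vertex_def)
    moreover have "pattern_colouring P f (remove_vertex Q v)"
      using f by (auto simp: pattern_colouring_def remove_vertex_def Q_def eG)
    ultimately have Qsub: "subconstruction r P (remove_vertex Q v)"
      using colouring_imp_subconstruction[OF assms(3)] by blast
    have degQ: "real (degree K u) \<le> real (degree Q u) + \<rho> * B"
      if K: "r_graph r K" "verts K = ?V" and u: "u \<in> ?V" "u \<notin> Y" and Y: "Y \<subseteq> insert v Z"
        and KQ: "{e \<in> edges K. u \<in> e \<and> e \<inter> Y = {}} \<subseteq> edges Q" for K u Y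
    proof -
      have "{e \<in> edges K. u \<in> e} \<subseteq> {e \<in> edges Q. u \<in> e} \<union> {e \<in> edges K. u \<in> e \<and> e \<inter> Y \<noteq> {}}"
        using KQ by blast
      then have "degree K u \<le> card ({e \<in> edges Q. u \<in> e} \<union> {e \<in> edges K. u \<in> e \<and> e \<inter> Y \<noteq> {}})"
        unfolding degree_def using finQ r_graph_finite_edges[OF K(1)] by (intro card_mono) auto
      also have "\<dots> \<le> degree Q u + card {e \<in> edges K. u \<in> e \<and> e \<inter> Y \<noteq> {}}"
        unfolding degree_def by (rule card_Un_le)
      finally show ?thesis using loss[OF K u Y] by linarith
    qed
    have vQdeg: "real (degree H v) \<le> real (degree Q v) + \<rho> * B"
      by (rule degQ[OF H(1) refl v Z(2)]) (auto simp: Q_def)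
    have \<rho>B: "\<rho> * B \<le> \<zeta> / 2 * B" "\<rho> * B \<le> \<epsilon> / 2 * B" using \<rho> B0 by (auto intro!: mult_right_mono)
    have lower: "(?p - \<zeta>) * B \<le> real (degree Q u)" if u: "u \<in> verts Q" for u
    proof (cases "u = v")
      case True
      have "\<zeta> * B > 0" "\<epsilon> * B > 0" using \<zeta> assms(7) B0 by simp_all
      then show ?thesis using vQdeg vdeg \<rho>B True by (simp add: algebra_simps)
    next
      case False
      then have "real (degree G u) \<le> real (degree Q u) + \<rho> * B"
        using u by (intro degQ[OF Gr vG, of _ "insert v Z"]) (auto simp: Q_def)
      moreover have "real (degree G u) > (?p - \<theta>) * B" using u False by (auto simp: Q_def Z_def)
      ultimately show ?thesis using \<rho>B by (simp add: algebra_simps \<theta>_def)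
    qed
    have "min_degree Q \<in> degree Q ` verts Q"
      unfolding min_degree_def using finV vQ by (intro Min_in) (auto simp: Q_def)
    then obtain u where u: "u \<in> verts Q" "min_degree Q = degree Q u" by auto
    have "(?p - \<zeta>) * B' \<le> real (min_degree Q)"
    \<comment> \<open>Passing from \<open>B\<close> to the smaller \<open>B'\<close> preserves the
      lower bound only for a nonnegative factor; otherwise the claim is trivial.\<close>
    proof (cases "?p - \<zeta> \<ge> 0")
      case True
      then have "(?p - \<zeta>) * B' \<le> (?p - \<zeta>) * B" using B' by (intro mult_left_mono)
      then show ?thesis using lower[OF u(1)] u(2) by linarith
    next
      case False
      then have "(?p - \<zeta>) * B' \<le> 0" using B' by (simp add: mult_nonpos_nonneg)
      then show ?thesis by linarith
    qed
    then have "real (degree Q v) \<le> (?p + \<epsilon> / 2) * B'"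
      unfolding B'_def using free_subgraph[OF H(2) QH] n halfZ cardQ
      by (intro WVE[OF Qr _ _ _ vQ Qsub]) auto
    also have "\<dots> \<le> (?p + \<epsilon> / 2) * B" using B' p assms(7) by (intro mult_left_mono) auto
    \<comment> \<open>The degree of \<open>v\<close> in \<open>H\<close> is at most (p + \<epsilon>
      / 2) B + \<rho> B <= (p + \<epsilon>) B.\<close>
    finally show False using vQdeg vdeg \<rho>B by (simp add: algebra_simps)
  qed
  show ?thesis by (intro exI[of _ c] conjI exI[of _ N] c) (use main in blast)
qed

section \<open>Translation into boundedness\<close>

theorem theorem1p11:
  fixes r m :: nat and F :: hgraph and P :: pattern
  assumes "r \<ge> 1"
    and "r_graph r F" and "card (verts F) = m"
    and "is_pattern r P" and "minimal_pattern r P"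
    and "turan_pair r F P"
    and "edge_stable r F P"
    and "weakly_vertex_extendable r F P \<or> vertex_extendable r F P"
  shows "\<exists>c::real. c > 0 \<and> (\<forall>\<^sub>F n in sequentially.
           degree_bounded r F n (c * real ((n - 1) choose (r - 1)))
             ((1 - turan_density r F) / (8 * real m) * real ((n - 1) choose (r - 1))))"
proof -
  let ?p = "turan_density r F"
  define \<epsilon> where "\<epsilon> = (1 - ?p) / (8 * real m)"
  have ne: "edges F \<noteq> {}" using turan_pair_edges_nonempty assms by blast
  then obtain e where e: "e \<in> edges F" by blast
  \<comment> \<open>This excludes \<open>m = 0\<close>, where division by zero would give \<epsilon>
    = 0.\<close>
  have "r \<le> m"
    using r_graph_edgeD[OF assms(2) e] assms(2,3) card_mono[of "verts F" e] by (auto simp: r_graph_def)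
  then have "\<epsilon> > 0" using turan_density_less_1[OF assms(2) ne] assms(1) by (simp add: \<epsilon>_def)
  moreover have "weakly_vertex_extendable r F P"
    using assms vertex_extendable_imp_weakly by blast
  ultimately obtain c N where c: "c > 0" and N: "\<And>H v. \<lbrakk>r_graph r H; free F H; card (verts H) \<ge> N;
      real (card (edges H)) \<ge> (?p - c) * real (card (verts H) choose r); v \<in> verts H\<rbrakk> \<Longrightarrow>
      real (degree H v) \<le> (?p + \<epsilon>) * real ((card (verts H) - 1) choose (r - 1))"
    using weakly_vertex_extendable_degree_le[OF assms(1,2,4,6,7)] by blast
  have "degree_bounded r F n (c * real ((n - 1) choose (r - 1))) (\<epsilon> * real ((n - 1) choose (r - 1)))"
    if n: "n \<ge> max N 1" for n
    unfolding degree_bounded_def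
  proof (intro allI impI, elim conjE)
    fix H assume H: "r_graph r H" "free F H" "card (verts H) = n"
      and avg: "avg_degree H \<ge> turan_degree r n F - c * real ((n - 1) choose (r - 1))"
    define B where "B = real ((n - 1) choose (r - 1))"
    \<comment> \<open>By this identity, an average-degree deficit c B amounts to an edge deficit c
      binom(n, r).\<close>
    have rC: "real r * real (n choose r) = real n * B"
      using binomial_step[OF assms(1), of n] by (simp only: B_def of_nat_mult[symmetric])
    have "(\<Sum>v\<in>verts H. real (degree H v)) = real r * real (card (edges H))"
      using sum_degree[OF H(1)] by (simp only: of_nat_sum[symmetric] of_nat_mult)
    then have "real r * real (card (edges H)) / real n \<ge> real r * real (turan_ex r n F) / real n - c * B"
      using avg H(3) by (simp add: avg_degree_def turan_degree_def B_def)
    then have "(real r * real (turan_ex r n F) / real n - c * B) * real n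
        \<le> real r * real (card (edges H)) / real n * real n"
      by (rule mult_right_mono) simp
    then have "real r * real (card (edges H)) \<ge> real r * real (turan_ex r n F) - c * (real n * B)"
      using n by (simp add: left_diff_distrib nonzero_divide_eq_eq mult_ac right_diff_distrib)
    then have "real r * real (card (edges H)) \<ge> real r * (real (turan_ex r n F) - c * real (n choose r))"
      by (simp only: rC[symmetric] right_diff_distrib mult.left_commute)
    then have "real (card (edges H)) \<ge> real (turan_ex r n F) - c * real (n choose r)"
      using assms(1) by simp
    then have edges: "real (card (edges H)) \<ge> (?p - c) * real (n choose r)"
      using turan_density_le_ex[of r F n] by (simp add: algebra_simps)
    have "finite (verts H)" "verts H \<noteq> {}" using H n by (auto simp: r_graph_def)
    then have "max_degree H \<in> degree H ` verts H" unfolding max_degree_def by (intro Max_in) auto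
    then have "real (max_degree H) \<le> (?p + \<epsilon>) * B" using N[OF H(1,2)] H(3) n edges by (auto simp: B_def)
    \<comment> \<open>ex(n, F) >= p binom(n, r) holds for every n, so p B can be replaced by d(n, F)
      without an error term.\<close>
    moreover have "?p * B \<le> turan_degree r n F"
    proof -
      have "?p * (real n * B) = real r * (?p * real (n choose r))" by (simp add: rC[symmetric])
      also have "\<dots> \<le> real r * real (turan_ex r n F)" by (intro mult_left_mono turan_density_le_ex) auto
      finally show ?thesis using n by (simp add: turan_degree_def field_simps)
    qed
    ultimately show "real (max_degree H) \<le> turan_degree r n F + \<epsilon> * real ((n - 1) choose (r - 1))"
      by (simp add: B_def algebra_simps)
  qed
  then show ?thesis unfolding \<epsilon>_def[symmetric] using c
    by (intro exI[of _ c] conjI eventually_sequentiallyI[of "max N 1"])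
qed

end
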